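(* Let $\theta$ be a lacunary sequence, let $E\subseteq\mathbb{R}$, and let $(f_j)_{j\in\mathbb{N}}$ be a sequence of $ASC_\theta$ continuous functions $f_j:E\to\mathbb{R}$ which converges uniformly on $E$ to a function $f:E\to\mathbb{R}$. Then $f$ is $ASC_\theta$ continuous.
   Context: Sequences $x=(x_m)$ are real sequences indexed by the positive integers. For positive integers $m,n$, $\langle m,n\rangle$ denotes the greatest common divisor of $m$ and $n$. The number of elements of a finite set $A$ is denoted $|A|$. A lacunary sequence is a strictly increasing sequence $\theta=(k_r)_{r\ge 0}$ of nonnegative integers such that $h_r:=k_r-k_{r-1}\to\infty$ as $r\to\infty$. For $r\ge1$ put $I_r=(k_{r-1},k_r]$ (viewed as a set of integers). A sequence $x=(x_m)$ is lacunary arithmetic statistically convergent (written $x\in ASC_\theta$) iff for each $\varepsilon>0$ there is a positive integer $n$ such that $$\lim_{r\to\infty}\frac1{h_r}\left|\{m\in I_r: |x_m-x_{\langle m,n\rangle}|\ge\varepsilon\}\right|=0.$$ A function $f:E\to\mathbb{R}$ on a subset $E\subseteq\mathbb{R}$ is $ASC_\theta$ continuous (lacunary arithmetic statistical continuous) if it preserves lacunary arithmetic statistical convergence, i.e. for every sequence $(x_m)$ of points of $E$ with $(x_m)\in ASC_\theta$, one has $(f(x_m))\in ASC_\theta$. *)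

theory Defs
  imports "HOL-Analysis.Analysis"
begin

text \<open>
  Sequences indexed by the positive integers are functions on \<^typ>\<open>nat\<close> whose value at 0 plays
  no role: the blocks below contain positive indices only, and \<^term>\<open>gcd m n\<close> is positive
  for positive \<^term>\<open>m\<close> and \<^term>\<open>n\<close>.
\<close>

text \<open>
  The block and its length are meant for \<^term>\<open>r \<ge> 1\<close>; at \<^term>\<open>r = 0\<close> they are the
  empty set and 0, which does not affect limits as \<^term>\<open>r\<close> tends to infinity.
  For strictly increasing \<^term>\<open>k\<close> the subtraction on \<^typ>\<open>nat\<close> does not truncate.
\<close>

definition block_length :: "(nat \<Rightarrow> nat) \<Rightarrow> nat \<Rightarrow> nat" where
  "block_length k r = k r - k (r - 1)"

definition block :: "(nat \<Rightarrow> nat) \<Rightarrow> nat \<Rightarrow> nat set" where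
  "block k r = {k (r - 1)<..k r}"

definition lacunary :: "(nat \<Rightarrow> nat) \<Rightarrow> bool" where
  "lacunary k \<longleftrightarrow> strict_mono k \<and> filterlim (block_length k) at_top sequentially"

definition ASC :: "(nat \<Rightarrow> nat) \<Rightarrow> (nat \<Rightarrow> real) set" where
  "ASC \<theta> = {x. \<forall>\<epsilon>>0. \<exists>n\<ge>1.
     (\<lambda>r. 1 / real (block_length \<theta> r) *
        real (card {m \<in> block \<theta> r. \<bar>x m - x (gcd m n)\<bar> \<ge> \<epsilon>})) \<longlonglongrightarrow> 0}"

text \<open>
  A function on a subset \<^term>\<open>E\<close> of the reals is a total function of which only the values
  on \<^term>\<open>E\<close> matter.
\<close>

definition ASC_continuous_on :: "(nat \<Rightarrow> nat) \<Rightarrow> real set \<Rightarrow> (real \<Rightarrow> real) \<Rightarrow> bool" where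
  "ASC_continuous_on \<theta> E f \<longleftrightarrow>
     (\<forall>x. (\<forall>m\<ge>1. x m \<in> E) \<and> x \<in> ASC \<theta> \<longrightarrow> (\<lambda>m. f (x m)) \<in> ASC \<theta>)"

end

theory Submission
  imports Defs
begin

text \<open>
  If \<open>\<bar>x - y\<bar> < \<epsilon>/3\<close> uniformly, then every index at which \<open>x\<close> deviates from its gcd value by at
  least \<open>\<epsilon>\<close> is one at which \<open>y\<close> deviates by at least \<open>\<epsilon>/3\<close>. Hence lacunary arithmetic statistical
  convergence is closed under uniform approximation, and the theorem follows by approximating
  \<open>g \<circ> x\<close> by \<open>f j \<circ> x\<close>.
\<close>

lemma ASC_uniform_approx:
  assumes approx: "\<And>e. e > 0 \<Longrightarrow> \<exists>y\<in>ASC \<theta>. \<forall>m\<ge>1. \<bar>x m - y m\<bar> < e"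
  shows "x \<in> ASC \<theta>"
  unfolding ASC_def
proof (intro CollectI allI impI)
  fix e :: real
  assume "e > 0"
  then obtain y where "y \<in> ASC \<theta>" and close: "\<And>m. m \<ge> 1 \<Longrightarrow> \<bar>x m - y m\<bar> < e / 3"
    using approx[of "e / 3"] by auto
  \<comment> \<open>The modulus \<open>n\<close> that serves \<open>y\<close> at tolerance
    \<open>e / 3\<close> is reused for \<open>x\<close> at tolerance \<open>e\<close>.\<close>
  then obtain n where "n \<ge> 1"
    and lim: "(\<lambda>r. 1 / real (block_length \<theta> r) *
      real (card {m \<in> block \<theta> r. \<bar>y m - y (gcd m n)\<bar> \<ge> e / 3})) \<longlonglongrightarrow> 0"
    using \<open>e > 0\<close> unfolding ASC_def by (auto dest!: spec[of _ "e / 3"])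
  have "{m \<in> block \<theta> r. \<bar>x m - x (gcd m n)\<bar> \<ge> e}
      \<subseteq> {m \<in> block \<theta> r. \<bar>y m - y (gcd m n)\<bar> \<ge> e / 3}" for r
  proof clarsimp
    fix m
    assume "m \<in> block \<theta> r" and dev: "e \<le> \<bar>x m - x (gcd m n)\<bar>"
    \<comment> \<open>\<open>close\<close> says nothing at index 0. Blocks are open on the left, so
      \<open>m\<close> is positive, and hence so is its gcd with \<open>n\<close>.\<close>
    then have "m \<ge> 1" and "gcd m n \<ge> 1"
      by (auto simp: block_def Suc_le_eq)
    \<comment> \<open>Triangle inequality: replacing \<open>x\<close> by \<open>y\<close> at
      \<open>m\<close> and at \<open>gcd m n\<close> costs less than \<open>e / 3\<close> each time,
      which leaves at least \<open>e / 3\<close> of the deviation.\<close>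
    from this[THEN close] dev show "e \<le> \<bar>y m - y (gcd m n)\<bar> * 3"
      by (simp add: abs_less_iff abs_if split: if_splits)
  qed
  then have "card {m \<in> block \<theta> r. \<bar>x m - x (gcd m n)\<bar> \<ge> e}
      \<le> card {m \<in> block \<theta> r. \<bar>y m - y (gcd m n)\<bar> \<ge> e / 3}" for r
    by (intro card_mono) (auto simp: block_def)
  then have "(\<lambda>r. 1 / real (block_length \<theta> r) *
      real (card {m \<in> block \<theta> r. \<bar>x m - x (gcd m n)\<bar> \<ge> e})) \<longlonglongrightarrow> 0"
    by (intro tendsto_sandwich[OF _ _ tendsto_const lim] always_eventually allI mult_left_mono) auto
  with \<open>n \<ge> 1\<close> show "\<exists>n\<ge>1. (\<lambda>r. 1 / real (block_length \<theta> r) *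
      real (card {m \<in> block \<theta> r. \<bar>x m - x (gcd m n)\<bar> \<ge> e})) \<longlonglongrightarrow> 0"
    by blast
qed

theorem theorem3p1:
  fixes \<theta> :: "nat \<Rightarrow> nat"
    and E :: "real set"
    and f :: "nat \<Rightarrow> real \<Rightarrow> real"
    and g :: "real \<Rightarrow> real"
  assumes "lacunary \<theta>"
    and "\<And>j. ASC_continuous_on \<theta> E (f j)"
    and "uniform_limit E f g sequentially"
  shows "ASC_continuous_on \<theta> E g"
  unfolding ASC_continuous_on_def
proof (intro allI impI, elim conjE)
  fix x :: "nat \<Rightarrow> real"
  assume x: "\<forall>m\<ge>1. x m \<in> E" "x \<in> ASC \<theta>"
  show "(\<lambda>m. g (x m)) \<in> ASC \<theta>"
  proof (rule ASC_uniform_approx)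
    fix e :: real
    assume "e > 0"
    \<comment> \<open>Uniformity gives a single \<open>j\<close> for all points of \<open>E\<close>,
      so \<open>j\<close> does not depend on the index \<open>m\<close>.\<close>
    then obtain j where "\<forall>t\<in>E. dist (f j t) (g t) < e"
      using eventually_happens'[OF sequentially_bot uniform_limitD[OF assms(3)]] by blast
    moreover have "(\<lambda>m. f j (x m)) \<in> ASC \<theta>"
      using assms(2)[of j] x unfolding ASC_continuous_on_def by blast
    ultimately show "\<exists>y\<in>ASC \<theta>. \<forall>m\<ge>1. \<bar>g (x m) - y m\<bar> < e"
      using x(1) by (intro bexI[of _ "\<lambda>m. f j (x m)"]) (auto simp: dist_real_def abs_minus_commute)
  qed
qed

end
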